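(* Let $E=(N,C,A,k)$ be an election with maximum ballot size $b=\max_{i\in N}|A_i|$, and let $W$ be the committee returned by Reverse Sequential PAV on $E$. Then $\operatorname{PAV}(W)\ge\frac1b\operatorname{OPT}_k$.
   Context: An election is a tuple $E=(N,C,A,k)$, where $N=\{1,\ldots,n\}$ is a set of voters, $C$ is a set of $m$ candidates, $A=(A_i)_{i\in N}$ is a profile of approval ballots $A_i\subseteq C$, and $k$ is the desired committee size. It is assumed that $1\le k<m$ and that $A_i\ne\emptyset$ for at least one voter $i$. A committee is a set $W\subseteq C$ with $|W|=k$. For an integer $t\ge 0$, $H(t)=\sum_{j=1}^{t}1/j$ (so $H(0)=0$). For $S\subseteq C$, $\operatorname{PAV}(S)=\sum_{i\in N}H(|A_i\cap S|)$, and for $c\in S$ the marginal loss is $\Delta_S(c)=\operatorname{PAV}(S)-\operatorname{PAV}(S\setminus\{c\})$. $\operatorname{OPT}_k$ is the maximum of $\operatorname{PAV}(W')$ over all committees $W'\subseteq C$ with $|W'|=k$. Reverse Sequential PAV: let $C_m=C$; for $s=m,m-1,\ldots,k+1$ pick $c_s\in\arg\min_{c\in C_s}\Delta_{C_s}(c)$ and set $C_{s-1}=C_s\setminus\{c_s\}$; return $W=C_k$. Ties are resolved using a fixed priority (linear) order on candidates. *)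

theory Defs
  imports "HOL-Analysis.Harmonic_Numbers"
begin

text \<open>
  An election is given by the number \<open>n\<close> of voters (the voters are \<open>1, \<dots>, n\<close>), the candidate set
  \<open>C\<close>, the ballots \<open>A\<close> (only \<open>A 1, \<dots>, A n\<close> are relevant) and the committee size \<open>k\<close>.
\<close>

definition election :: "nat \<Rightarrow> 'c set \<Rightarrow> (nat \<Rightarrow> 'c set) \<Rightarrow> nat \<Rightarrow> bool" where
  "election n C A k \<longleftrightarrow>
     finite C \<and> 1 \<le> k \<and> k < card C \<and>
     (\<forall>i\<in>{1..n}. A i \<subseteq> C) \<and> (\<exists>i\<in>{1..n}. A i \<noteq> {})"

definition committees :: "'c set \<Rightarrow> nat \<Rightarrow> 'c set set" where
  "committees C k = {W. W \<subseteq> C \<and> card W = k}"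

definition max_ballot_size :: "nat \<Rightarrow> (nat \<Rightarrow> 'c set) \<Rightarrow> nat" where
  "max_ballot_size n A = Max ((\<lambda>i. card (A i)) ` {1..n})"

definition PAV :: "nat \<Rightarrow> (nat \<Rightarrow> 'c set) \<Rightarrow> 'c set \<Rightarrow> real" where
  "PAV n A S = (\<Sum>i=1..n. harm (card (A i \<inter> S)))"

definition marginal_loss :: "nat \<Rightarrow> (nat \<Rightarrow> 'c set) \<Rightarrow> 'c set \<Rightarrow> 'c \<Rightarrow> real" where
  "marginal_loss n A S c = PAV n A S - PAV n A (S - {c})"

definition OPT :: "nat \<Rightarrow> 'c set \<Rightarrow> (nat \<Rightarrow> 'c set) \<Rightarrow> nat \<Rightarrow> real" where
  "OPT n C A k = Max (PAV n A ` committees C k)"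

definition min_loss_candidates :: "nat \<Rightarrow> (nat \<Rightarrow> 'c set) \<Rightarrow> 'c set \<Rightarrow> 'c set" where
  "min_loss_candidates n A S = {c. is_arg_min (marginal_loss n A S) (\<lambda>d. d \<in> S) c}"

text \<open>
  Among the tied candidates, the least one with respect to the linear order \<open>prio\<close> is removed.
  Statements quantify over all linear orders, so the orientation of \<open>prio\<close> is immaterial.
\<close>

definition removed_candidate ::
    "('c \<times> 'c) set \<Rightarrow> nat \<Rightarrow> (nat \<Rightarrow> 'c set) \<Rightarrow> 'c set \<Rightarrow> 'c" where
  "removed_candidate prio n A S =
     (THE c. c \<in> min_loss_candidates n A S \<and> (\<forall>d\<in>min_loss_candidates n A S. (c, d) \<in> prio))"

text \<open>
  With \<open>m = card C\<close>, the set of candidates left after \<open>j\<close> removals has size \<open>m - j\<close>;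
  the rule stops after \<open>m - k\<close> removals.
\<close>

primrec remaining ::
    "('c \<times> 'c) set \<Rightarrow> nat \<Rightarrow> 'c set \<Rightarrow> (nat \<Rightarrow> 'c set) \<Rightarrow> nat \<Rightarrow> 'c set" where
  "remaining prio n C A 0 = C"
| "remaining prio n C A (Suc j) =
     remaining prio n C A j - {removed_candidate prio n A (remaining prio n C A j)}"

definition reverse_seq_PAV ::
    "('c \<times> 'c) set \<Rightarrow> nat \<Rightarrow> 'c set \<Rightarrow> (nat \<Rightarrow> 'c set) \<Rightarrow> nat \<Rightarrow> 'c set" where
  "reverse_seq_PAV prio n C A k = remaining prio n C A (card C - k)"

end

theory Submission
  imports Defs
begin

text \<open>
  Let \<open>O\<close> be an optimal committee. A candidate \<open>c \<in> O - W\<close> is removed at a stage \<open>S \<supseteq> W\<close>, where its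
  loss is at least \<open>1 / b\<close> times its number of approvals; by the choice of the rule and since losses
  grow as the set shrinks, this is at most the loss in \<open>W\<close> of any \<open>w \<in> W\<close>. Pairing \<open>O - W\<close> with the
  equally large set \<open>W - O\<close> gives \<open>PAV(O) - PAV(O \<inter> W) \<le> b (PAV(W) - PAV(O \<inter> W))\<close>, and
  \<open>b \<ge> 1\<close> finishes the proof.
\<close>

text \<open>Unlike a marginal loss, this count does not depend on a set \<open>S\<close>, so it can
  link the gain from a candidate in one committee to its loss at an earlier removal stage.\<close>

definition approvals :: "nat \<Rightarrow> (nat \<Rightarrow> 'c set) \<Rightarrow> 'c \<Rightarrow> nat" where
  "approvals n A c = card {i \<in> {1..n}. c \<in> A i}"

lemma approvals_eq_sum: "real (approvals n A c) = (\<Sum>i=1..n. if c \<in> A i then 1 else 0)"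
  by (simp add: approvals_def sum.If_cases Int_def conj_commute)

text \<open>Only voters approving \<open>c\<close> are affected, and each loses exactly the last
  summand of its harmonic number.\<close>

lemma marginal_loss_eq_sum:
  assumes "finite S" "c \<in> S"
  shows "marginal_loss n A S c = (\<Sum>i=1..n. if c \<in> A i then 1 / real (card (A i \<inter> S)) else 0)"
proof -
  have "harm (card (A i \<inter> S)) - harm (card (A i \<inter> (S - {c})))
      = (if c \<in> A i then 1 / real (card (A i \<inter> S)) else 0)" for i
  proof (cases "c \<in> A i")
    case True
    have "card (A i \<inter> S) = Suc (card (A i \<inter> S - {c}))"
      using assms True by (intro card.remove) auto
    moreover have "A i \<inter> S - {c} = A i \<inter> (S - {c})" by blast
    ultimately have "card (A i \<inter> S) = Suc (card (A i \<inter> (S - {c})))" by simp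
    then show ?thesis using True by (simp add: harm_Suc inverse_eq_divide)
  next
    case False
    then have "A i \<inter> (S - {c}) = A i \<inter> S" by blast
    then show ?thesis using False by simp
  qed
  then show ?thesis
    by (simp add: marginal_loss_def PAV_def flip: sum_subtractf)
qed

lemma marginal_loss_antimono:
  assumes "finite S" "T \<subseteq> S" "c \<in> T"
  shows "marginal_loss n A S c \<le> marginal_loss n A T c"
proof -
  have fin: "finite T" using assms finite_subset by blast
  have "1 / real (card (A i \<inter> S)) \<le> 1 / real (card (A i \<inter> T))" if "c \<in> A i" for i
  proof -
    have "card (A i \<inter> T) \<le> card (A i \<inter> S)" using assms by (intro card_mono) auto
    \<comment> \<open>Since \<open>1 / 0 = 0\<close>, the comparison of reciprocals needs a positive
      smaller denominator; \<open>c\<close> itself lies in \<open>A i \<inter> T\<close>.\<close>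
    moreover have "card (A i \<inter> T) > 0" using fin assms that by (auto simp: card_gt_0_iff)
    ultimately show ?thesis by (intro divide_left_mono) auto
  qed
  moreover have "c \<in> S" using assms by blast
  ultimately show ?thesis
    using assms fin by (simp add: marginal_loss_eq_sum) (intro sum_mono, auto)
qed

lemma marginal_loss_le_approvals:
  assumes "finite S" "c \<in> S"
  shows "marginal_loss n A S c \<le> real (approvals n A c)"
  unfolding marginal_loss_eq_sum[OF assms] approvals_eq_sum
  by (intro sum_mono) (simp add: divide_le_eq)

text \<open>Each approver of \<open>c\<close> contributes at least \<open>1 / b\<close> to the loss.
  This is the source of the factor \<open>b\<close> in the final bound.\<close>

lemma approvals_le_marginal_loss:
  assumes "finite S" "c \<in> S" and "\<And>i. i \<in> {1..n} \<Longrightarrow> card (A i \<inter> S) \<le> b"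
  shows "real (approvals n A c) \<le> real b * marginal_loss n A S c"
proof -
  have "(if c \<in> A i then 1 else 0)
      \<le> real b * (if c \<in> A i then 1 / real (card (A i \<inter> S)) else 0)" if "i \<in> {1..n}" for i
  proof (cases "c \<in> A i")
    case True
    then have "card (A i \<inter> S) > 0" using assms by (auto simp: card_gt_0_iff)
    then show ?thesis using assms(3)[OF that] True by (simp add: le_divide_eq)
  qed simp
  then show ?thesis
    unfolding marginal_loss_eq_sum[OF assms(1,2)] approvals_eq_sum sum_distrib_left
    by (rule sum_mono)
qed

text \<open>Add the elements of \<open>D\<close> one at a time: each gain is a marginal loss in the
  enlarged set, and no approver gains more than 1.\<close>

lemma PAV_Un_le:
  assumes "finite D" "finite S" "D \<inter> S = {}"
  shows "PAV n A (S \<union> D) \<le> PAV n A S + (\<Sum>d\<in>D. real (approvals n A d))"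
  using assms
proof (induction D rule: finite_induct)
  case (insert d D)
  then have "S \<union> insert d D - {d} = S \<union> D" by blast
  then show ?case
    using insert marginal_loss_le_approvals[of "S \<union> insert d D" d n A]
    by (simp add: marginal_loss_def)
qed simp

text \<open>Remove the elements of \<open>D\<close> one at a time: by antimonotonicity, each costs
  at least as much in the shrunken set as it did in \<open>S\<close>.\<close>

lemma sum_marginal_loss_le:
  assumes "finite D" "finite S" "D \<subseteq> S"
  shows "(\<Sum>d\<in>D. marginal_loss n A S d) \<le> PAV n A S - PAV n A (S - D)"
  using assms
proof (induction D rule: finite_induct)
  case (insert d D)
  then have "marginal_loss n A S d \<le> marginal_loss n A (S - D) d"
    by (intro marginal_loss_antimono) auto
  moreover have "S - D - {d} = S - insert d D" by blast
  ultimately show ?case using insert by (simp add: marginal_loss_def)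
qed simp

text \<open>Supplies the existence half of what the \<open>THE\<close> in
  \<open>removed_candidate\<close> requires.\<close>

lemma linear_order_on_ex_least:
  assumes "finite M" "M \<noteq> {}" "M \<subseteq> C" "linear_order_on C r"
  shows "\<exists>c\<in>M. \<forall>d\<in>M. (c, d) \<in> r"
  using assms(1-3)
proof (induction rule: finite_ne_induct)
  case (singleton x)
  then show ?case using assms(4) by (auto simp: order_on_defs refl_on_def)
next
  case (insert x F)
  then obtain c where c: "c \<in> F" "\<forall>d\<in>F. (c, d) \<in> r" by auto
  have refl: "(x, x) \<in> r"
    using insert.prems assms(4) by (auto simp: order_on_defs refl_on_def)
  have tr: "trans r" using assms(4) by (auto simp: order_on_defs)
  have "x \<noteq> c" "x \<in> C" "c \<in> C" using c(1) insert.hyps insert.prems by auto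
  then have "(x, c) \<in> r \<or> (c, x) \<in> r"
    using assms(4) by (auto simp: order_on_defs total_on_def)
  then show ?case
  proof
    assume "(x, c) \<in> r"
    then have "\<forall>d\<in>insert x F. (x, d) \<in> r" using c refl transD[OF tr] by blast
    then show ?thesis by blast
  next
    assume "(c, x) \<in> r"
    then show ?thesis using c by blast
  qed
qed

lemma removed_candidate_min_loss:
  assumes "finite C" "linear_order_on C prio" "S \<subseteq> C" "S \<noteq> {}"
  shows "removed_candidate prio n A S \<in> min_loss_candidates n A S"
proof -
  let ?M = "min_loss_candidates n A S"
  have fin: "finite S" using assms finite_subset by blast
  have sub: "?M \<subseteq> C"
    using assms(3) by (auto simp: min_loss_candidates_def is_arg_min_def)
  have "?M \<noteq> {}"
    using ex_is_arg_min_if_finite[OF fin assms(4)] by (auto simp: min_loss_candidates_def)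
  moreover have "finite ?M" using sub assms(1) finite_subset by blast
  ultimately have "\<exists>c\<in>?M. \<forall>d\<in>?M. (c, d) \<in> prio"
    using linear_order_on_ex_least sub assms(2) by blast
  moreover have "antisym prio" using assms(2) by (auto simp: order_on_defs)
  \<comment> \<open>Antisymmetry gives uniqueness, so the \<open>THE\<close> denotes an actual
    minimiser.\<close>
  ultimately have "\<exists>!c. c \<in> ?M \<and> (\<forall>d\<in>?M. (c, d) \<in> prio)"
    by (metis antisymD)
  from theI'[OF this] show ?thesis
    unfolding removed_candidate_def by blast
qed

lemma removed_candidate_in:
  assumes "finite C" "linear_order_on C prio" "S \<subseteq> C" "S \<noteq> {}"
  shows "removed_candidate prio n A S \<in> S"
  using removed_candidate_min_loss[OF assms, of n A]
  by (simp add: min_loss_candidates_def is_arg_min_def)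

lemma marginal_loss_removed_candidate_le:
  assumes "finite C" "linear_order_on C prio" "S \<subseteq> C" "d \<in> S"
  shows "marginal_loss n A S (removed_candidate prio n A S) \<le> marginal_loss n A S d"
  using removed_candidate_min_loss[OF assms(1,2,3), of n A] assms(4)
  by (force simp: min_loss_candidates_def is_arg_min_def not_less)

lemma remaining_antimono:
  "i \<le> j \<Longrightarrow> remaining prio n C A j \<subseteq> remaining prio n C A i"
  by (rule lift_Suc_antimono_le) auto

lemma card_remaining:
  assumes "finite C" "linear_order_on C prio" "j \<le> card C"
  shows "card (remaining prio n C A j) = card C - j"
  using assms(3)
proof (induction j)
  case (Suc j)
  let ?S = "remaining prio n C A j"
  have card: "card ?S = card C - j" using Suc by simp
  have "?S \<subseteq> C" using remaining_antimono[of 0 j prio n C A] by simp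
  \<comment> \<open>From \<open>Suc j \<le> card C\<close> some candidate is left, so the removed
    candidate belongs to \<open>?S\<close> and the difference really shrinks it.\<close>
  moreover have "?S \<noteq> {}" using card Suc.prems by auto
  ultimately have "removed_candidate prio n A ?S \<in> ?S"
    by (rule removed_candidate_in[OF assms(1,2)])
  then show ?case using card by (simp add: card_Diff_singleton)
qed simp

text \<open>Recovers the stage at which \<open>c\<close> was dropped, where the minimality of its
  loss can be exploited.\<close>

lemma notin_remaining_imp_removed:
  "c \<in> C \<Longrightarrow> c \<notin> remaining prio n C A j \<Longrightarrow>
     \<exists>i<j. c \<in> remaining prio n C A i \<and> c = removed_candidate prio n A (remaining prio n C A i)"
  by (induction j) (auto simp: less_Suc_eq)

lemma approvals_removed_le_marginal_loss:
  assumes "finite C" "linear_order_on C prio"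
    and "\<And>i. i \<in> {1..n} \<Longrightarrow> A i \<subseteq> C" "\<And>i. i \<in> {1..n} \<Longrightarrow> card (A i) \<le> b"
    and W: "W = remaining prio n C A j"
    and "c \<in> C - W" "w \<in> W"
  shows "real (approvals n A c) \<le> real b * marginal_loss n A W w"
proof -
  obtain i where i: "i < j" "c \<in> remaining prio n C A i"
      "c = removed_candidate prio n A (remaining prio n C A i)"
    using notin_remaining_imp_removed[of c C prio n A j] assms(6) unfolding W by blast
  define S where "S = remaining prio n C A i"
  have SC: "S \<subseteq> C" using remaining_antimono[of 0 i prio n C A] by (simp add: S_def)
  have fin: "finite S" using SC assms(1) finite_subset by blast
  have WS: "W \<subseteq> S"
    unfolding W S_def using i(1) by (intro remaining_antimono) simp
  have "card (A i \<inter> S) \<le> b" if "i \<in> {1..n}" for i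
  proof -
    have "finite (A i)" using assms(1) assms(3)[OF that] finite_subset by blast
    then have "card (A i \<inter> S) \<le> card (A i)" by (intro card_mono) auto
    then show ?thesis using assms(4)[OF that] by linarith
  qed
  then have "real (approvals n A c) \<le> real b * marginal_loss n A S c"
    using approvals_le_marginal_loss[OF fin] i(2) by (simp add: S_def)
  \<comment> \<open>As \<open>w\<close> survives to the end, it was still available at stage
    \<open>S\<close>, where the rule preferred to remove \<open>c\<close>.\<close>
  also have "marginal_loss n A S c \<le> marginal_loss n A S w"
    using marginal_loss_removed_candidate_le[OF assms(1,2) SC] i(3) WS assms(7)
    by (auto simp: S_def)
  also have "marginal_loss n A S w \<le> marginal_loss n A W w"
    using marginal_loss_antimono[OF fin WS assms(7)] .
  finally show ?thesis by (simp add: mult_left_mono)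
qed

theorem theorem9:
  fixes n k b :: nat
    and C W :: "'c set"
    and A :: "nat \<Rightarrow> 'c set"
    and prio :: "('c \<times> 'c) set"
  assumes "election n C A k"
    and "linear_order_on C prio"
    and "b = max_ballot_size n A"
    and "W = reverse_seq_PAV prio n C A k"
  shows "PAV n A W \<ge> (1 / real b) * OPT n C A k"
proof -
  have finC: "finite C" and k: "k < card C" and AC: "\<And>i. i \<in> {1..n} \<Longrightarrow> A i \<subseteq> C"
    and ne: "\<exists>i\<in>{1..n}. A i \<noteq> {}"
    using assms(1) by (auto simp: election_def)
  have W: "W = remaining prio n C A (card C - k)"
    using assms(4) by (simp add: reverse_seq_PAV_def)
  have WC: "W \<subseteq> C"
    unfolding W using remaining_antimono[of 0 "card C - k" prio n C A] by simp
  have finW: "finite W" using WC finC finite_subset by blast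
  have cardW: "card W = k" unfolding W using card_remaining[OF finC assms(2)] k by simp
  have b: "card (A i) \<le> b" if "i \<in> {1..n}" for i
    unfolding assms(3) max_ballot_size_def using that by (intro Max_ge) auto
  \<comment> \<open>Used twice: to discard the shared part of the two committees and to divide by
    \<open>b\<close> at the end.\<close>
  have b1: "1 \<le> b"
  proof -
    obtain i where i: "i \<in> {1..n}" "A i \<noteq> {}" using ne by blast
    moreover have "finite (A i)" using AC[OF i(1)] finC finite_subset by blast
    ultimately have "card (A i) > 0" by (simp add: card_gt_0_iff)
    then show ?thesis using b[OF i(1)] by linarith
  qed
  \<comment> \<open>The argument for the optimal committee works for any committee \<open>V\<close>,
    so no maximiser has to be chosen.\<close>
  have bound: "PAV n A V \<le> real b * PAV n A W" if V: "V \<in> committees C k" for V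
  proof -
    have VC: "V \<subseteq> C" and cardV: "card V = k" using V by (auto simp: committees_def)
    have finV: "finite V" using VC finC finite_subset by blast
    \<comment> \<open>Both committees have size \<open>k\<close> and share
      \<open>V \<inter> W\<close>; this equality yields the pairing \<open>f\<close>.\<close>
    have "card (V - W) = card (W - V)"
      using card_Diff_subset_Int[of V W] card_Diff_subset_Int[of W V] finV finW cardV cardW
      by (simp add: Int_commute)
    then obtain f where f: "bij_betw f (V - W) (W - V)"
      using finite_same_card_bij[of "V - W" "W - V"] finV finW by auto
    have "(V - W) \<inter> (V \<inter> W) = {}" by blast
    then have PAV_V: "PAV n A V \<le> PAV n A (V \<inter> W) + (\<Sum>c\<in>V - W. real (approvals n A c))"
      using PAV_Un_le[of "V - W" "V \<inter> W" n A] finV by (simp add: Int_Diff_Un)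
    have "(\<Sum>c\<in>V - W. real (approvals n A c))
        \<le> (\<Sum>c\<in>V - W. real b * marginal_loss n A W (f c))"
    proof (rule sum_mono)
      fix c assume c: "c \<in> V - W"
      then have "f c \<in> W" using bij_betwE[OF f] by blast
      then show "real (approvals n A c) \<le> real b * marginal_loss n A W (f c)"
        using c VC by (intro approvals_removed_le_marginal_loss[OF finC assms(2) AC b W]) auto
    qed
    also have "\<dots> = real b * (\<Sum>w\<in>W - V. marginal_loss n A W w)"
      using sum.reindex_bij_betw[OF f, of "marginal_loss n A W"]
      by (simp flip: sum_distrib_left)
    also have "\<dots> \<le> real b * (PAV n A W - PAV n A (W - (W - V)))"
      using finW by (intro mult_left_mono sum_marginal_loss_le) auto
    also have "W - (W - V) = V \<inter> W" by blast
    finally have "PAV n A V \<le> PAV n A (V \<inter> W) + real b * (PAV n A W - PAV n A (V \<inter> W))"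
      using PAV_V by linarith
    moreover have "0 \<le> (real b - 1) * PAV n A (V \<inter> W)"
      using b1 by (simp add: PAV_def sum_nonneg harm_nonneg)
    ultimately show ?thesis by (simp add: algebra_simps)
  qed
  have "finite (committees C k)"
    using finC by (simp add: committees_def)
  \<comment> \<open>Makes the set under \<open>Max\<close> nonempty, as \<open>Max_le_iff\<close>
    demands.\<close>
  moreover have "W \<in> committees C k"
    using WC cardW by (simp add: committees_def)
  ultimately have "OPT n C A k \<le> real b * PAV n A W"
    unfolding OPT_def using bound by (subst Max_le_iff) auto
  then show ?thesis using b1 by (simp add: divide_le_eq mult.commute)
qed

end
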